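(* Let $S$ be a factorizable Boolean sublattice all of whose quarks have size at most $2$. The following are equivalent: (a) $S$ is a UFS; (b) for each connected component $C$ of the pairing graph $\mathcal{G}_p(S)$, the Boolean sublattice $\langle E(C)\rangle$ generated by the edges of $C$ (viewed as $2$-element subsets of $\mathbb{N}$) is a UFS; (c) each connected component of $\mathcal{G}_p(S)$ is a tree with diameter at most $3$.
   Context: Let $B_{\mathbb{N}}$ be the set of all finite subsets of $\mathbb{N}=\{1,2,3,\dots\}$, ordered by inclusion. A Boolean sublattice is a subset $S\subseteq B_{\mathbb{N}}$ containing $\emptyset$ and closed under finite unions. For a collection $T$ of finite subsets of $\mathbb{N}$, $\langle T\rangle$ denotes the smallest Boolean sublattice containing $T$. A quark of $S$ is a nonempty $A\in S$ such that no $B\in S$ satisfies $\emptyset\subsetneq B\subsetneq A$; $\mathcal{A}(S)$ is the set of quarks. $S$ is factorizable if every nonempty element of $S$ is a union of finitely many quarks. For nonempty $X\in S$, a factorization of $X$ in $S$ is a finite set $z\subseteq\mathcal{A}(S)$ with $\bigcup z=X$ and $\bigcup z'\subsetneq X$ for every proper subset $z'\subsetneq z$. $S$ is a UFS if every nonempty $X\in S$ has exactly one factorization. The pairing graph $\mathcal{G}_p(S)$ is the simple graph with vertex set $\mathbb{N}$ and an edge between distinct $a,b$ whenever $\{a,b\}\in\mathcal{A}(S)$ (graphs may be infinite; the diameter of a tree is the maximum length of a path in it). *)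

theory Defs
  imports Main "HOL-Library.Extended_Nat"
begin

definition BN :: "nat set set" where
  "BN = {A. finite A \<and> A \<subseteq> {1..}}"

definition boolean_sublattice :: "nat set set \<Rightarrow> bool" where
  "boolean_sublattice S \<longleftrightarrow> S \<subseteq> BN \<and> {} \<in> S \<and> (\<forall>A\<in>S. \<forall>B\<in>S. A \<union> B \<in> S)"

text \<open>The intersection is over a nonempty family, and hence is the smallest Boolean
  sublattice containing \<open>T\<close>, whenever \<open>T \<subseteq> BN\<close>.\<close>

definition generated :: "nat set set \<Rightarrow> nat set set" where
  "generated T = \<Inter>{S. boolean_sublattice S \<and> T \<subseteq> S}"

definition quarks :: "nat set set \<Rightarrow> nat set set" where
  "quarks S = {A \<in> S. A \<noteq> {} \<and> \<not> (\<exists>B\<in>S. {} \<subset> B \<and> B \<subset> A)}"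

definition factorizable :: "nat set set \<Rightarrow> bool" where
  "factorizable S \<longleftrightarrow>
     (\<forall>X\<in>S. X \<noteq> {} \<longrightarrow> (\<exists>z. finite z \<and> z \<subseteq> quarks S \<and> \<Union>z = X))"

definition is_factorization :: "nat set set \<Rightarrow> nat set \<Rightarrow> nat set set \<Rightarrow> bool" where
  "is_factorization S X z \<longleftrightarrow>
     finite z \<and> z \<subseteq> quarks S \<and> \<Union>z = X \<and> (\<forall>z'. z' \<subset> z \<longrightarrow> \<Union>z' \<subset> X)"

definition UFS :: "nat set set \<Rightarrow> bool" where
  "UFS S \<longleftrightarrow> (\<forall>X\<in>S. X \<noteq> {} \<longrightarrow> (\<exists>!z. is_factorization S X z))"

text \<open>A graph is a pair of a vertex set and a set of edges, each edge being a
  two-element set of vertices.\<close>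

type_synonym 'a graph = "'a set \<times> 'a set set"

definition verts :: "'a graph \<Rightarrow> 'a set" where
  "verts G = fst G"

definition edges :: "'a graph \<Rightarrow> 'a set set" where
  "edges G = snd G"

definition is_walk :: "'a graph \<Rightarrow> 'a list \<Rightarrow> bool" where
  "is_walk G p \<longleftrightarrow>
     p \<noteq> [] \<and> set p \<subseteq> verts G \<and> (\<forall>i. Suc i < length p \<longrightarrow> {p ! i, p ! Suc i} \<in> edges G)"

definition is_path :: "'a graph \<Rightarrow> 'a list \<Rightarrow> bool" where
  "is_path G p \<longleftrightarrow> is_walk G p \<and> distinct p"

text \<open>A cycle is listed without repeating its first vertex at the end.\<close>

definition is_cycle :: "'a graph \<Rightarrow> 'a list \<Rightarrow> bool" where
  "is_cycle G p \<longleftrightarrow> is_path G p \<and> length p \<ge> 3 \<and> {last p, hd p} \<in> edges G"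

definition reachable :: "'a graph \<Rightarrow> 'a \<Rightarrow> 'a \<Rightarrow> bool" where
  "reachable G u v \<longleftrightarrow> (\<exists>p. is_walk G p \<and> hd p = u \<and> last p = v)"

definition connected_graph :: "'a graph \<Rightarrow> bool" where
  "connected_graph G \<longleftrightarrow> verts G \<noteq> {} \<and> (\<forall>u\<in>verts G. \<forall>v\<in>verts G. reachable G u v)"

definition induced :: "'a graph \<Rightarrow> 'a set \<Rightarrow> 'a graph" where
  "induced G W = (W, {e \<in> edges G. e \<subseteq> W})"

definition components :: "'a graph \<Rightarrow> 'a graph set" where
  "components G = {induced G {v. reachable G u v} | u. u \<in> verts G}"

definition is_tree :: "'a graph \<Rightarrow> bool" where
  "is_tree G \<longleftrightarrow> connected_graph G \<and> \<not> (\<exists>p. is_cycle G p)"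

text \<open>The length of a path is its number of edges. The supremum is the maximum if the
  lengths are bounded, and \<open>\<infinity>\<close> otherwise. For trees, whose paths are geodesics, this is
  the usual diameter.\<close>

definition tree_diameter :: "'a graph \<Rightarrow> enat" where
  "tree_diameter G = (SUP p \<in> {p. is_path G p}. enat (length p - 1))"

definition pairing_graph :: "nat set set \<Rightarrow> nat graph" where
  "pairing_graph S =
     ({1..}, {{a, b} | a b. a \<in> {1..} \<and> b \<in> {1..} \<and> a \<noteq> b \<and> {a, b} \<in> quarks S})"

end

theory Submission
  imports Defs
begin

text \<open>
  All three conditions are equivalent to the absence of a non-backtracking walk \<open>a, b, c, d, e\<close>
  with four edges in the pairing graph. Given such a walk, \<open>{ab, bc, de}\<close> and \<open>{ab, cd, de}\<close> have
  the same union, but no common edge contains \<open>c\<close>. Conversely, let \<open>bc\<close> lie in one factorization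
  of \<open>X\<close> but not in another one. The other one contains edges \<open>ab\<close> and \<open>cd\<close>, and as one of the ends
  of \<open>bc\<close>, say \<open>c\<close>, is covered only by \<open>bc\<close> in the first factorization, \<open>d\<close> is covered there by an
  edge \<open>de\<close> with \<open>e \<noteq> c\<close>. Such walks stay within a component, and they are
  excluded in a tree of diameter at most 3; a cycle, or a path with more than three edges,
  contains one.
\<close>

text \<open>Only vertices two steps apart must differ: \<open>a = d\<close>, \<open>b = e\<close>
  and \<open>a = e\<close> stay possible, so triangles and 4-cycles are captured along with paths.
  Taking a bare family of sets lets the notion apply to quarks and to graph edges alike.\<close>

definition nonbacktracking_4walk :: "'a set set \<Rightarrow> bool" where
  "nonbacktracking_4walk F \<longleftrightarrow>
     (\<exists>a b c d e. {a, b} \<in> F \<and> {b, c} \<in> F \<and> {c, d} \<in> F \<and> {d, e} \<in> F \<and> a \<noteq> c \<and> b \<noteq> d \<and> c \<noteq> e)"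

section \<open>Factorizations\<close>

lemma quark_subset_eq: "A \<in> quarks S \<Longrightarrow> B \<in> quarks S \<Longrightarrow> A \<subseteq> B \<Longrightarrow> A = B"
  unfolding quarks_def by blast

lemma Union_in_sublattice:
  assumes "boolean_sublattice S" "finite z" "z \<subseteq> S"
  shows "\<Union>z \<in> S"
  using assms(2,3)
proof (induction z rule: finite_induct)
  case empty
  then show ?case using assms(1) by (simp add: boolean_sublattice_def)
next
  case (insert A z)
  then show ?case using assms(1) by (auto simp: boolean_sublattice_def)
qed

text \<open>Among the finitely many subfamilies of \<open>z\<close> with union \<open>X\<close>, an
  inclusion-minimal one is irredundant.\<close>

lemma factorization_within_cover:
  assumes "finite z" "z \<subseteq> quarks S" "\<Union>z = X"
  obtains y where "y \<subseteq> z" "is_factorization S X y"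
proof -
  let ?P = "{y. y \<subseteq> z \<and> \<Union>y = X}"
  have "finite ?P" "z \<in> ?P"
    using assms by auto
  then obtain y where y: "y \<subseteq> z" "\<Union>y = X" "\<forall>y'\<in>?P. y' \<subseteq> y \<longrightarrow> y = y'"
    using finite_has_minimal2[of ?P z] by force
  have "\<Union>y' \<subset> X" if "y' \<subset> y" for y'
  proof -
    have "\<Union>y' \<noteq> X"
      using that y(1,3) by auto
    moreover have "\<Union>y' \<subseteq> X"
      using that y(2) by auto
    ultimately show ?thesis by auto
  qed
  moreover have "finite y" "y \<subseteq> quarks S"
    using y(1) assms(1,2) finite_subset by auto
  ultimately have "is_factorization S X y"
    unfolding is_factorization_def using y(2) by simp
  with y(1) that show ?thesis by blast
qed

text \<open>Deleting \<open>A\<close> from an irredundant cover must uncover some point, and no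
  other member contains that point.\<close>

lemma factorization_private_element:
  assumes "is_factorization S X z" "A \<in> z"
  obtains x where "x \<in> A" "\<And>B. B \<in> z \<Longrightarrow> x \<in> B \<Longrightarrow> B = A"
proof -
  have "z - {A} \<subset> z"
    using assms(2) by blast
  with assms(1) have "\<Union>(z - {A}) \<subset> \<Union>z"
    by (simp add: is_factorization_def)
  then obtain x where "x \<in> \<Union>z" "x \<notin> \<Union>(z - {A})" by blast
  with that show ?thesis by blast
qed

text \<open>Both covers thin out to factorizations of the same set; by uniqueness these agree, so
  they lie in \<open>z \<inter> w\<close>. Uniqueness can thus be refuted by two covers that are not
  known to be irredundant.\<close>

lemma UFS_common_subcover:
  assumes "boolean_sublattice S" "UFS S"
    and "finite z" "z \<subseteq> quarks S" "finite w" "w \<subseteq> quarks S" "\<Union>z = \<Union>w"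
  shows "\<Union>z = \<Union>(z \<inter> w)"
proof (cases "\<Union>z = {}")
  case False
  obtain y where y: "y \<subseteq> z" "is_factorization S (\<Union>z) y"
    using factorization_within_cover[OF assms(3,4) refl] .
  obtain y' where y': "y' \<subseteq> w" "is_factorization S (\<Union>z) y'"
    using factorization_within_cover[OF assms(5,6) assms(7)[symmetric]] .
  have "\<Union>z \<in> S"
    using assms(4) by (intro Union_in_sublattice assms) (auto simp: quarks_def)
  with False assms(2) y y' have "y = y'"
    unfolding UFS_def by blast
  with y(1) y'(1) have "y \<subseteq> z \<inter> w" by simp
  moreover have "\<Union>y = \<Union>z"
    using y(2) by (simp add: is_factorization_def)
  ultimately show ?thesis by blast
qed blast

lemma UFS_imp_no_nonbacktracking_4walk:
  assumes "boolean_sublattice S" "UFS S"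
  shows "\<not> nonbacktracking_4walk {A \<in> quarks S. card A = 2}"
proof
  assume "nonbacktracking_4walk {A \<in> quarks S. card A = 2}"
  then obtain a b c d e where q: "{a, b} \<in> quarks S" "{b, c} \<in> quarks S" "{c, d} \<in> quarks S"
    "{d, e} \<in> quarks S" and neq: "a \<noteq> c" "b \<noteq> d" "c \<noteq> e"
    and card: "card {b, c} = 2" "card {c, d} = 2"
    unfolding nonbacktracking_4walk_def by blast
  let ?z = "{{a, b}, {b, c}, {d, e}}" and ?w = "{{a, b}, {c, d}, {d, e}}"
  have "b \<noteq> c" "c \<noteq> d"
    using card by auto
  \<comment> \<open>Vertices of the walk may coincide, and even \<open>{a, b} = {d, e}\<close> is
    possible in a triangle. Following the single point \<open>c\<close> avoids a case split.\<close>
  have "\<Union>?z = \<Union>(?z \<inter> ?w)"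
    by (rule UFS_common_subcover[OF assms]) (use q in auto)
  moreover have "c \<in> \<Union>?z" by simp
  ultimately have "c \<in> \<Union>(?z \<inter> ?w)" by (simp only:)
  then obtain A where "A \<in> ?z" "A \<in> ?w" "c \<in> A" by (elim UnionE IntE)
  moreover have "c \<notin> {a, b}" "c \<notin> {d, e}"
    using neq \<open>b \<noteq> c\<close> \<open>c \<noteq> d\<close> by simp_all
  ultimately have "A = {b, c}" "A = {c, d}" by blast+
  then have "b \<in> {c, d}" by blast
  with neq \<open>b \<noteq> c\<close> show False by simp
qed

text \<open>One inclusion suffices for uniqueness, since \<open>z\<close> and \<open>w\<close> can
  be exchanged. Singleton quarks cause no difference: by minimality, no other quark contains their
  point.\<close>

lemma factorization_subset_if_no_nonbacktracking_4walk:
  assumes small: "\<forall>A\<in>quarks S. card A \<le> 2" and fin: "\<forall>A\<in>quarks S. finite A"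
    and nowalk: "\<not> nonbacktracking_4walk {A \<in> quarks S. card A = 2}"
    and z: "is_factorization S X z" and w: "is_factorization S X w"
  shows "z \<subseteq> w"
proof
  fix A assume "A \<in> z"
  have zq: "z \<subseteq> quarks S" and wq: "w \<subseteq> quarks S" and un: "\<Union>z = X" "\<Union>w = X"
    using z w unfolding is_factorization_def by iprover+
  have "A \<in> quarks S"
    using \<open>A \<in> z\<close> zq by blast
  \<comment> \<open>Finiteness and nonemptiness exclude \<open>card B = 0\<close>, the default value
    for infinite sets included; size 1 would make \<open>{x}\<close> a quark.\<close>
  have edge: "\<exists>y. B = {x, y} \<and> y \<noteq> x" if B: "B \<in> quarks S" "x \<in> B" and ne: "{x} \<notin> quarks S" for B x
  proof -
    have "card B \<le> 2" "finite B" "card B \<noteq> 0"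
      using that small fin by auto
    moreover have "card B \<noteq> 1"
      using B ne by (auto simp: card_1_singleton_iff)
    ultimately have "card B = 2" by linarith
    with B(2) show ?thesis
      by (auto simp: card_2_iff)
  qed
  have singleton: "{x} \<notin> quarks S" if "B \<in> quarks S" "x \<in> B" "B \<noteq> {x}" for B x
    using quark_subset_eq[of "{x}" S B] that by blast
  obtain c where c: "c \<in> A" "\<And>B. B \<in> z \<Longrightarrow> c \<in> B \<Longrightarrow> B = A"
    using factorization_private_element[OF z \<open>A \<in> z\<close>] by blast
  show "A \<in> w"
  proof (rule ccontr)
    assume "A \<notin> w"
    have cover: "\<exists>B\<in>w. x \<in> B" if "x \<in> A" for x
      using that \<open>A \<in> z\<close> un by blast
    \<comment> \<open>Otherwise \<open>{c}\<close> would be the only quark through \<open>c\<close>,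
      hence equal to \<open>A\<close> and to the member of \<open>w\<close> covering
      \<open>c\<close>.\<close>
    have "{c} \<notin> quarks S"
    proof
      assume "{c} \<in> quarks S"
      then have "A = {c}"
        using quark_subset_eq[of "{c}" S A] \<open>A \<in> quarks S\<close> c(1) by blast
      moreover obtain B where "B \<in> w" "c \<in> B" using cover c(1) by blast
      ultimately have "B = {c}"
        using quark_subset_eq[of "{c}" S B] \<open>{c} \<in> quarks S\<close> wq by blast
      with \<open>A = {c}\<close> \<open>A \<notin> w\<close> \<open>B \<in> w\<close> show False by simp
    qed
    then obtain b where A: "A = {c, b}" "b \<noteq> c"
      using edge \<open>A \<in> quarks S\<close> c(1) by blast
    obtain C where "C \<in> w" "c \<in> C" using cover c(1) by blast
    then obtain d where d: "C = {c, d}" "d \<noteq> c"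
      using edge[of C c] \<open>{c} \<notin> quarks S\<close> wq by blast
    have "b \<noteq> d" using d A \<open>C \<in> w\<close> \<open>A \<notin> w\<close> by blast
    have "{b} \<notin> quarks S"
      using singleton \<open>A \<in> quarks S\<close> A by blast
    obtain B where "B \<in> w" "b \<in> B" using cover A by blast
    then obtain a where a: "B = {b, a}" "a \<noteq> b"
      using edge[of B b] \<open>{b} \<notin> quarks S\<close> wq by blast
    have "a \<noteq> c" using a A \<open>B \<in> w\<close> \<open>A \<notin> w\<close> by (auto simp: insert_commute)
    have "{d} \<notin> quarks S"
      using singleton[of C d] \<open>C \<in> w\<close> wq d by blast
    obtain D where "D \<in> z" "d \<in> D"
      using un \<open>C \<in> w\<close> d by blast
    then obtain e where e: "D = {d, e}" "e \<noteq> d"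
      using edge[of D d] \<open>{d} \<notin> quarks S\<close> zq by blast
    \<comment> \<open>If \<open>e = c\<close>, then \<open>D\<close> contains the private point
      \<open>c\<close> and equals \<open>A\<close>, which forces \<open>d = b\<close>.\<close>
    have "c \<noteq> e"
      using c(2)[of D] \<open>D \<in> z\<close> e A d \<open>b \<noteq> d\<close> by blast
    have "{a, b} \<in> quarks S" "{b, c} \<in> quarks S" "{c, d} \<in> quarks S" "{d, e} \<in> quarks S"
      using \<open>B \<in> w\<close> \<open>C \<in> w\<close> \<open>A \<in> z\<close> \<open>D \<in> z\<close> zq wq a A d e by (auto simp: insert_commute)
    moreover have "card {a, b} = 2" "card {b, c} = 2" "card {c, d} = 2" "card {d, e} = 2"
      using a A d e by auto
    ultimately have "nonbacktracking_4walk {A \<in> quarks S. card A = 2}"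
      unfolding nonbacktracking_4walk_def using \<open>a \<noteq> c\<close> \<open>b \<noteq> d\<close> \<open>c \<noteq> e\<close> by blast
    with nowalk show False ..
  qed
qed

lemma UFS_iff_no_nonbacktracking_4walk:
  assumes "boolean_sublattice S" "factorizable S" "\<forall>A\<in>quarks S. card A \<le> 2"
  shows "UFS S \<longleftrightarrow> \<not> nonbacktracking_4walk {A \<in> quarks S. card A = 2}"
proof
  assume nowalk: "\<not> nonbacktracking_4walk {A \<in> quarks S. card A = 2}"
  have fin: "\<forall>A\<in>quarks S. finite A"
    using assms(1) by (auto simp: quarks_def boolean_sublattice_def BN_def)
  show "UFS S"
    unfolding UFS_def
  proof (intro ballI impI ex_ex1I)
    fix X assume "X \<in> S" "X \<noteq> {}"
    then obtain z where "finite z" "z \<subseteq> quarks S" "\<Union>z = X"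
      using assms(2) unfolding factorizable_def by blast
    then show "\<exists>z. is_factorization S X z"
      using factorization_within_cover by blast
  next
    fix X z w assume "is_factorization S X z" "is_factorization S X w"
    then show "z = w"
      using factorization_subset_if_no_nonbacktracking_4walk[OF assms(3) fin nowalk] by blast
  qed
qed (use UFS_imp_no_nonbacktracking_4walk assms in blast)

section \<open>Sublattices generated by two-element sets\<close>

lemma boolean_sublattice_finite_unions:
  assumes "T \<subseteq> BN"
  shows "boolean_sublattice {\<Union>z | z. finite z \<and> z \<subseteq> T}" (is "boolean_sublattice ?U")
  unfolding boolean_sublattice_def
proof (intro conjI ballI)
  show "?U \<subseteq> BN" using assms by (fastforce simp: BN_def)
  show "{} \<in> ?U" by (auto intro: exI[of _ "{}"])
next
  fix A B assume "A \<in> ?U" "B \<in> ?U"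
  then obtain z w where "A = \<Union>z" "B = \<Union>w" "finite z" "finite w" "z \<subseteq> T" "w \<subseteq> T" by blast
  then show "A \<union> B \<in> ?U" by (auto intro!: exI[of _ "z \<union> w"])
qed

text \<open>The finite unions form a sublattice containing \<open>T\<close>, and every sublattice
  containing \<open>T\<close> contains them. The empty family accounts for the empty set.\<close>

lemma generated_eq:
  assumes "T \<subseteq> BN"
  shows "generated T = {\<Union>z | z. finite z \<and> z \<subseteq> T}" (is "_ = ?U")
proof
  have "T \<subseteq> ?U"
  proof
    fix A assume "A \<in> T"
    then show "A \<in> ?U" by (auto intro!: exI[of _ "{A}"])
  qed
  then show "generated T \<subseteq> ?U"
    unfolding generated_def using boolean_sublattice_finite_unions[OF assms] by blast
  show "?U \<subseteq> generated T"
    unfolding generated_def using Union_in_sublattice by blast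
qed

text \<open>Two-element sets form an antichain, and each nonempty finite union of members of
  \<open>T\<close> contains one of them; so the minimal nonempty elements are exactly the members of
  \<open>T\<close>. This makes the walk criterion applicable to the generated sublattice.\<close>

lemma generated_by_pairs:
  assumes "T \<subseteq> BN" "\<forall>A\<in>T. card A = 2"
  shows "boolean_sublattice (generated T)" "quarks (generated T) = T" "factorizable (generated T)"
proof -
  show "boolean_sublattice (generated T)"
    using boolean_sublattice_finite_unions generated_eq assms(1) by simp
  have sub: "T \<subseteq> generated T"
    unfolding generated_def by blast
  have below: "\<exists>B\<in>T. B \<subseteq> A" if "A \<in> generated T" "A \<noteq> {}" for A
  proof -
    obtain z where "A = \<Union>z" "z \<subseteq> T"
      using \<open>A \<in> generated T\<close> by (auto simp: generated_eq[OF assms(1)])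
    with \<open>A \<noteq> {}\<close> show ?thesis by blast
  qed
  have eq: "A = B" if "A \<in> T" "B \<in> T" "A \<subseteq> B" for A B
    using that assms(2) card_subset_eq[of B A] by (metis card.infinite zero_neq_numeral)
  show q: "quarks (generated T) = T"
  proof
    show "quarks (generated T) \<subseteq> T"
    proof
      fix A assume A: "A \<in> quarks (generated T)"
      then obtain B where "B \<in> T" "B \<subseteq> A" using below[of A] by (auto simp: quarks_def)
      moreover have "B \<noteq> {}" using \<open>B \<in> T\<close> assms(2) by force
      ultimately have "B = A" using A sub by (auto simp: quarks_def)
      with \<open>B \<in> T\<close> show "A \<in> T" by simp
    qed
    show "T \<subseteq> quarks (generated T)"
    proof
      fix A assume A: "A \<in> T"
      have False if "B \<in> generated T" "{} \<subset> B" "B \<subset> A" for B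
        using below[of B] eq[of _ A] that A by blast
      moreover have "A \<noteq> {}" using A assms(2) by force
      ultimately show "A \<in> quarks (generated T)" using A sub by (auto simp: quarks_def)
    qed
  qed
  show "factorizable (generated T)"
    unfolding factorizable_def q by (auto simp: generated_eq[OF assms(1)])
qed

section \<open>Components\<close>

lemma is_walk_singleton: "is_walk G [x] \<longleftrightarrow> x \<in> verts G"
  by (simp add: is_walk_def)

text \<open>Replaces the indexed condition by a recursion on the list, for inductions and for
  simplifying explicit walks.\<close>

lemma is_walk_Cons_Cons:
  "is_walk G (x # y # p) \<longleftrightarrow> x \<in> verts G \<and> {x, y} \<in> edges G \<and> is_walk G (y # p)"
proof
  assume L: "is_walk G (x # y # p)"
  have step: "{(x # y # p) ! i, (x # y # p) ! Suc i} \<in> edges G" if "Suc i < length (x # y # p)" for i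
    using L that unfolding is_walk_def by blast
  show "x \<in> verts G \<and> {x, y} \<in> edges G \<and> is_walk G (y # p)"
    using L step[of 0] step[of "Suc i" for i] by (auto simp: is_walk_def)
next
  assume R: "x \<in> verts G \<and> {x, y} \<in> edges G \<and> is_walk G (y # p)"
  show "is_walk G (x # y # p)"
    unfolding is_walk_def
  proof (intro conjI allI impI)
    fix i assume "Suc i < length (x # y # p)"
    then show "{(x # y # p) ! i, (x # y # p) ! Suc i} \<in> edges G"
      using R by (cases i) (auto simp: is_walk_def)
  qed (use R in \<open>auto simp: is_walk_def\<close>)
qed

lemmas is_walk_simps = is_walk_singleton is_walk_Cons_Cons

lemma walk_imp_rtranclp:
  "is_walk G p \<Longrightarrow> (\<lambda>x y. {x, y} \<in> edges G)\<^sup>*\<^sup>* (hd p) (last p)"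
proof (induction p rule: induct_list012)
  case (3 x y p)
  then show ?case
    by (auto simp: is_walk_simps intro: converse_rtranclp_into_rtranclp)
qed (auto simp: is_walk_def)

text \<open>The closure relates every \<open>u\<close> to itself, so \<open>u\<close> has to be
  required as a vertex; all later vertices lie on edges of \<open>G\<close>.\<close>

lemma reachable_iff_rtranclp:
  assumes "\<forall>e\<in>edges G. e \<subseteq> verts G"
  shows "reachable G u v \<longleftrightarrow> u \<in> verts G \<and> (\<lambda>x y. {x, y} \<in> edges G)\<^sup>*\<^sup>* u v"
proof
  assume "reachable G u v"
  then obtain p where "is_walk G p" "hd p = u" "last p = v"
    by (auto simp: reachable_def)
  with walk_imp_rtranclp[of G p] show "u \<in> verts G \<and> (\<lambda>x y. {x, y} \<in> edges G)\<^sup>*\<^sup>* u v"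
    by (auto simp: is_walk_def)
next
  assume "u \<in> verts G \<and> (\<lambda>x y. {x, y} \<in> edges G)\<^sup>*\<^sup>* u v"
  then have "(\<lambda>x y. {x, y} \<in> edges G)\<^sup>*\<^sup>* u v" "u \<in> verts G" by auto
  then show "reachable G u v"
  proof (induction rule: converse_rtranclp_induct)
    case base
    then show ?case
      by (auto simp: reachable_def is_walk_simps intro!: exI[of _ "[v]"])
  next
    case (step x y)
    then have "y \<in> verts G" using assms by auto
    with step obtain p where p: "is_walk G p" "hd p = y" "last p = v"
      by (auto simp: reachable_def)
    then obtain p' where "p = y # p'"
      by (cases p) (auto simp: is_walk_def)
    with p step have "is_walk G (x # p)" "last (x # p) = v"
      by (auto simp: is_walk_simps)
    then show ?case
      unfolding reachable_def by (intro exI[of _ "x # p"]) simp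
  qed
qed

text \<open>Every vertex passed on the way from \<open>u\<close> is itself reachable, so the edges
  used survive in the induced subgraph. Any two vertices are then joined through \<open>u\<close> by
  symmetry.\<close>

lemma connected_component:
  assumes wf: "\<forall>e\<in>edges G. e \<subseteq> verts G" and "C \<in> components G"
  shows "connected_graph C"
proof -
  obtain u where u: "u \<in> verts G" "C = induced G {v. reachable G u v}"
    using assms(2) by (auto simp: components_def)
  define R where "R = (\<lambda>x y. {x, y} \<in> edges C)"
  have vC: "verts C = {v. reachable G u v}" and eC: "edges C = {e \<in> edges G. e \<subseteq> verts C}"
    by (auto simp: u(2) induced_def verts_def edges_def)
  have wfC: "\<forall>e\<in>edges C. e \<subseteq> verts C"
    using eC by blast
  have from_u: "R\<^sup>*\<^sup>* u v" if "v \<in> verts C" for v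
  proof -
    have "(\<lambda>x y. {x, y} \<in> edges G)\<^sup>*\<^sup>* u v"
      using that reachable_iff_rtranclp[OF wf] by (simp add: vC)
    then show ?thesis
    proof (induction rule: rtranclp_induct)
      case (step y w)
      then have "(\<lambda>x y. {x, y} \<in> edges G)\<^sup>*\<^sup>* u w" by (simp add: rtranclp.rtrancl_into_rtrancl)
      then have "{y, w} \<subseteq> verts C"
        using step.hyps(1) u(1) reachable_iff_rtranclp[OF wf] by (simp add: vC)
      with step show ?case
        by (auto simp: R_def eC intro: rtranclp.rtrancl_into_rtrancl)
    qed blast
  qed
  have "symp R"
    by (auto simp: R_def insert_commute intro!: sympI)
  then have "R\<^sup>*\<^sup>* v w" if "v \<in> verts C" "w \<in> verts C" for v w
    using from_u[OF that(1)] from_u[OF that(2)] by (meson rtranclp_trans symp_rtranclp sympD)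
  moreover have "u \<in> verts C"
    using u(1) reachable_iff_rtranclp[OF wf] by (simp add: vC)
  ultimately show ?thesis
    unfolding connected_graph_def reachable_iff_rtranclp[OF wfC] R_def by blast
qed

lemma component_edges_subset: "C \<in> components G \<Longrightarrow> edges C \<subseteq> edges G"
  by (auto simp: components_def induced_def edges_def)

lemma component_edges_in_verts: "C \<in> components G \<Longrightarrow> \<forall>e\<in>edges C. e \<subseteq> verts C"
  by (auto simp: components_def induced_def edges_def verts_def)

lemma nonbacktracking_4walk_component_iff:
  assumes "\<forall>e\<in>edges G. e \<subseteq> verts G"
  shows "nonbacktracking_4walk (edges G) \<longleftrightarrow>
    (\<exists>C\<in>components G. nonbacktracking_4walk (edges C))"
proof
  assume "nonbacktracking_4walk (edges G)"
  then obtain a b c d e where E: "{a, b} \<in> edges G" "{b, c} \<in> edges G" "{c, d} \<in> edges G"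
    "{d, e} \<in> edges G" and neq: "a \<noteq> c" "b \<noteq> d" "c \<noteq> e"
    unfolding nonbacktracking_4walk_def by blast
  let ?C = "induced G {v. reachable G a v}"
  have V: "a \<in> verts G" using E assms by blast
  have next_vertex: "reachable G a y" if "reachable G a x" "{x, y} \<in> edges G" for x y
    using that unfolding reachable_iff_rtranclp[OF assms]
    by (auto intro: rtranclp.rtrancl_into_rtrancl)
  have "reachable G a a"
    using V by (simp add: reachable_iff_rtranclp[OF assms])
  then have "reachable G a a" "reachable G a b" "reachable G a c" "reachable G a d" "reachable G a e"
    using next_vertex E by blast+
  then have "nonbacktracking_4walk (edges ?C)"
    unfolding nonbacktracking_4walk_def using E neq
    by (intro exI[of _ a] exI[of _ b] exI[of _ c] exI[of _ d] exI[of _ e])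
      (simp add: induced_def edges_def)
  moreover have "?C \<in> components G" using V by (auto simp: components_def)
  ultimately show "\<exists>C\<in>components G. nonbacktracking_4walk (edges C)" by blast
next
  assume "\<exists>C\<in>components G. nonbacktracking_4walk (edges C)"
  then show "nonbacktracking_4walk (edges G)"
    using component_edges_subset unfolding nonbacktracking_4walk_def by fast
qed

section \<open>Trees of diameter at most three\<close>

text \<open>Four steps around the cycle, wrapping modulo its length if it is short. Since
  \<open>n\<close> is at least 3, two steps never return to the same vertex.\<close>

lemma cycle_imp_nonbacktracking_4walk:
  assumes "is_cycle G p"
  shows "nonbacktracking_4walk (edges G)"
proof -
  define n where "n = length p"
  define f where "f i = p ! (i mod n)" for i
  have n: "3 \<le> n" and dist: "distinct p" and p: "p \<noteq> []"
    and closing: "{last p, hd p} \<in> edges G"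
    using assms by (auto simp: is_cycle_def is_path_def n_def)
  have step: "{p ! i, p ! Suc i} \<in> edges G" if "Suc i < n" for i
    using that assms by (auto simp: is_cycle_def is_path_def is_walk_def n_def)
  have edge: "{f i, f (Suc i)} \<in> edges G" for i
  proof (cases "Suc (i mod n) = n")
    \<comment> \<open>This is the step from the last vertex back to the first, given by the closing
      edge.\<close>
    case True
    then have "i mod n = n - 1" "Suc i mod n = 0"
      by (simp_all add: mod_Suc)
    then have "f i = last p" "f (Suc i) = hd p"
      using p by (simp_all add: f_def last_conv_nth hd_conv_nth n_def)
    with closing show ?thesis by simp
  next
    case False
    then have "Suc (i mod n) < n"
      using n mod_less_divisor[of n i] by linarith
    with step[of "i mod n"] False show ?thesis by (simp add: f_def mod_Suc)
  qed
  have neq: "f i \<noteq> f (Suc (Suc i))" for i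
  proof -
    have "i mod n < n" using n by simp
    then have "i mod n \<noteq> Suc (Suc i) mod n"
      using n by (auto simp: mod_Suc)
    moreover have "i mod n < n" "Suc (Suc i) mod n < n" using n by auto
    ultimately show ?thesis
      unfolding f_def using dist by (simp add: nth_eq_iff_index_eq n_def)
  qed
  show ?thesis
    unfolding nonbacktracking_4walk_def using edge neq
    by (intro exI[of _ "f 0"] exI[of _ "f (Suc 0)"] exI[of _ "f (Suc (Suc 0))"]
        exI[of _ "f (Suc (Suc (Suc 0)))"] exI[of _ "f (Suc (Suc (Suc (Suc 0))))"]) blast
qed

lemma long_path_imp_nonbacktracking_4walk:
  assumes "is_path G p" "5 \<le> length p"
  shows "nonbacktracking_4walk (edges G)"
proof -
  obtain a b c d e q where "p = a # b # c # d # e # q"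
    using assms(2) by (auto simp: numeral_eq_Suc Suc_le_length_iff)
  with assms(1) show ?thesis
    unfolding nonbacktracking_4walk_def
    by (intro exI[of _ a] exI[of _ b] exI[of _ c] exI[of _ d] exI[of _ e])
      (simp add: is_path_def is_walk_simps)
qed

lemma nonbacktracking_4walk_imp_cycle_or_path:
  assumes wf: "\<forall>e\<in>edges G. e \<subseteq> verts G \<and> card e = 2" and "nonbacktracking_4walk (edges G)"
  shows "(\<exists>p. is_cycle G p) \<or> (\<exists>p. is_path G p \<and> length p = 5)"
proof -
  obtain a b c d e where E: "{a, b} \<in> edges G" "{b, c} \<in> edges G" "{c, d} \<in> edges G"
    "{d, e} \<in> edges G" and neq: "a \<noteq> c" "b \<noteq> d" "c \<noteq> e"
    using assms(2) unfolding nonbacktracking_4walk_def by blast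
  have V: "a \<in> verts G" "b \<in> verts G" "c \<in> verts G" "d \<in> verts G" "e \<in> verts G"
    using E wf by blast+
  have "card {a, b} = 2" "card {b, c} = 2" "card {c, d} = 2" "card {d, e} = 2"
    using E wf by blast+
  then have neq': "a \<noteq> b" "b \<noteq> c" "c \<noteq> d" "d \<noteq> e" by auto
  note defs = is_cycle_def is_path_def is_walk_simps
  \<comment> \<open>Neighbours on the walk differ because edges have two elements, and vertices two
    steps apart differ by assumption. Only these three pairs can coincide: the first two give
    triangles, the third a 4-cycle.\<close>
  consider "a = d" | "b = e" | "a = e" "a \<noteq> d" | "a \<noteq> d" "b \<noteq> e" "a \<noteq> e" by blast
  then show ?thesis
  proof cases
    case 1
    then have "is_cycle G [a, b, c]" using E V neq neq' by (simp add: defs)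
    then show ?thesis by blast
  next
    case 2
    then have "is_cycle G [b, c, d]" using E V neq neq' by (simp add: defs)
    then show ?thesis by blast
  next
    case 3
    then have "is_cycle G [a, b, c, d]" using E V neq neq' by (simp add: defs)
    then show ?thesis by blast
  next
    case 4
    then have "is_path G [a, b, c, d, e]" using E V neq neq' by (simp add: defs)
    then show ?thesis by (intro disjI2 exI[of _ "[a, b, c, d, e]"]) simp
  qed
qed

lemma tree_diameter_le_3_iff: "tree_diameter G \<le> 3 \<longleftrightarrow> (\<forall>p. is_path G p \<longrightarrow> length p \<le> 4)"
proof -
  \<comment> \<open>Three edges mean four vertices; for \<open>n = 0\<close> truncated subtraction
    yields 0, and both sides hold.\<close>
  have "enat (n - 1) \<le> 3 \<longleftrightarrow> n \<le> 4" for n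
    by (simp add: numeral_eq_enat) linarith
  then show ?thesis
    by (simp add: tree_diameter_def SUP_le_iff)
qed

lemma tree_diameter_le_3_iff_no_nonbacktracking_4walk:
  assumes "\<forall>e\<in>edges G. e \<subseteq> verts G \<and> card e = 2" "connected_graph G"
  shows "is_tree G \<and> tree_diameter G \<le> 3 \<longleftrightarrow> \<not> nonbacktracking_4walk (edges G)"
proof
  assume L: "is_tree G \<and> tree_diameter G \<le> 3"
  then show "\<not> nonbacktracking_4walk (edges G)"
    using nonbacktracking_4walk_imp_cycle_or_path[OF assms(1)]
    by (force simp: is_tree_def tree_diameter_le_3_iff)
next
  assume "\<not> nonbacktracking_4walk (edges G)"
  then show "is_tree G \<and> tree_diameter G \<le> 3"
    using cycle_imp_nonbacktracking_4walk[of G] long_path_imp_nonbacktracking_4walk[of G] assms(2)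
    by (force simp: is_tree_def tree_diameter_le_3_iff not_le[symmetric])
qed

section \<open>The pairing graph\<close>

lemma edges_pairing_graph:
  assumes "boolean_sublattice S"
  shows "edges (pairing_graph S) = {A \<in> quarks S. card A = 2}"
proof -
  \<comment> \<open>Members of \<open>BN\<close> avoid 0, so restricting the vertices to positive
    numbers loses no two-element quark.\<close>
  have "A \<subseteq> {1..}" if "A \<in> quarks S" for A
    using that assms by (auto simp: quarks_def boolean_sublattice_def BN_def)
  then show ?thesis
    by (fastforce simp: pairing_graph_def edges_def card_2_iff)
qed

theorem theorem4p6:
  fixes S :: "nat set set"
  assumes "boolean_sublattice S"
    and "factorizable S"
    and "\<forall>A\<in>quarks S. card A \<le> 2"
  shows "(UFS S \<longleftrightarrow> (\<forall>C\<in>components (pairing_graph S). UFS (generated (edges C)))) \<and>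
         (UFS S \<longleftrightarrow> (\<forall>C\<in>components (pairing_graph S). is_tree C \<and> tree_diameter C \<le> 3))"
proof -
  let ?G = "pairing_graph S"
  have wf: "\<forall>e\<in>edges ?G. e \<subseteq> verts ?G"
    by (auto simp: pairing_graph_def edges_def verts_def)
  have E: "edges ?G = {A \<in> quarks S. card A = 2}"
    using edges_pairing_graph assms(1) .
  have "UFS S \<longleftrightarrow> \<not> nonbacktracking_4walk (edges ?G)"
    using UFS_iff_no_nonbacktracking_4walk[OF assms] E by simp
  also have "\<dots> \<longleftrightarrow> (\<forall>C\<in>components ?G. \<not> nonbacktracking_4walk (edges C))"
    using nonbacktracking_4walk_component_iff[OF wf] by blast
  finally have main: "UFS S \<longleftrightarrow> (\<forall>C\<in>components ?G. \<not> nonbacktracking_4walk (edges C))" .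
  have "UFS (generated (edges C)) \<longleftrightarrow> \<not> nonbacktracking_4walk (edges C)"
    and "is_tree C \<and> tree_diameter C \<le> 3 \<longleftrightarrow> \<not> nonbacktracking_4walk (edges C)"
    if C: "C \<in> components ?G" for C
  proof -
    have card: "\<forall>A\<in>edges C. card A = 2" and quarks: "edges C \<subseteq> quarks S"
      using component_edges_subset[OF C] E by auto
    have "edges C \<subseteq> BN"
      using quarks assms(1) by (auto simp: quarks_def boolean_sublattice_def)
    \<comment> \<open>The quarks of the generated sublattice are the edges of \<open>C\<close>, so
      the criterion used for \<open>S\<close> now speaks of walks in \<open>C\<close>.\<close>
    note gen = generated_by_pairs[OF this card]
    have "{A \<in> edges C. card A = 2} = edges C" using card by blast
    then show "UFS (generated (edges C)) \<longleftrightarrow> \<not> nonbacktracking_4walk (edges C)"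
      using UFS_iff_no_nonbacktracking_4walk[OF gen(1,3)] gen(2) card by simp
    show "is_tree C \<and> tree_diameter C \<le> 3 \<longleftrightarrow> \<not> nonbacktracking_4walk (edges C)"
      using connected_component[OF wf C] component_edges_in_verts[OF C] card
      by (intro tree_diameter_le_3_iff_no_nonbacktracking_4walk) auto
  qed
  with main show ?thesis by simp
qed

end
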